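(* Let $f$ and $g$ be transcendental entire functions with $f\circ g=g\circ f$. Then $F(f\circ g)\subset F(f)\cap F(g)$.
   Context: For an entire function $h$, $h^n$ denotes the $n$-th iterate; the Fatou set $F(h)$ is the set of $z\in\mathbb{C}$ having a neighborhood on which the family $\{h^n\}_{n\in\mathbb{N}}$ is normal. *)

theory Defs
  imports "HOL-Analysis.Analysis" "HOL-Computational_Algebra.Polynomial"
begin

definition entire :: "(complex \<Rightarrow> complex) \<Rightarrow> bool" where
  "entire f \<longleftrightarrow> f holomorphic_on UNIV"

definition transcendental_entire :: "(complex \<Rightarrow> complex) \<Rightarrow> bool" where
  "transcendental_entire f \<longleftrightarrow> entire f \<and> \<not> (\<exists>p. \<forall>z. f z = poly p z)"

definition normal_family :: "complex set \<Rightarrow> (complex \<Rightarrow> complex) set \<Rightarrow> bool" where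
  "normal_family U F \<longleftrightarrow>
     (\<forall>s::nat \<Rightarrow> complex \<Rightarrow> complex. (\<forall>n. s n \<in> F) \<longrightarrow>
        (\<exists>r. strict_mono r \<and>
           ((\<exists>g. \<forall>K. compact K \<and> K \<subseteq> U \<longrightarrow> uniform_limit K (\<lambda>n. s (r n)) g sequentially)
            \<or> (\<forall>K. compact K \<and> K \<subseteq> U \<longrightarrow>
                 (\<forall>M::real. eventually (\<lambda>n. \<forall>z\<in>K. M \<le> norm (s (r n) z)) sequentially)))))"

definition fatou_set :: "(complex \<Rightarrow> complex) \<Rightarrow> complex set" where
  "fatou_set h = {z. \<exists>U. open U \<and> z \<in> U \<and> normal_family U (range (\<lambda>n. h ^^ n))}"

end

theory Submission
  imports Defs "HOL-Complex_Analysis.Complex_Analysis"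
begin

text \<open>
  Write \<open>h = f \<circ> g = g \<circ> f\<close>. The Fatou set of \<open>h\<close> is forward invariant under \<open>f\<close>: along a sequence of
  iterates, \<open>h\<^bsup>n+1\<^esup> = g \<circ> (h\<^bsup>n\<^esup> \<circ> f)\<close> subconverges locally uniformly. If the limit is infinite then
  \<open>h\<^bsup>n\<^esup> \<circ> f\<close> tends to infinity as well; if it is finite then \<open>g\<close> is bounded on the values of \<open>h\<^bsup>n\<^esup> \<circ> f\<close>,
  which therefore omit two points, and Montel's theorem applies. Hence all iterates of \<open>f\<close> map the
  Fatou set of \<open>h\<close> into itself, so they omit the Julia set of \<open>h\<close>, and Montel's theorem finishes the
  proof once the Julia set of \<open>h\<close> has two points.

  Suppose that it is contained in \<open>{a}\<close>. Boundedness of orbits is then constant on the complement of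
  \<open>a\<close>. All orbits bounded is impossible, since by Schottky's theorem the maximum of \<open>\<bar>h\<^bsup>n\<^esup>\<bar>\<close> on a large
  circle of radius \<open>R\<close> is at least \<open>2\<^bsup>n\<^esup> R\<close>. If no orbit is bounded, then
  \<open>(h (h z) - z) / (h z - z)\<close> omits 0 and 1 off \<open>a\<close>, and Picard's little theorem makes \<open>h\<close> affine.
\<close>

section \<open>Montel's theorem for two omitted values\<close>

text \<open>The two alternatives in the definition of normality, for one fixed sequence; the second
  disjunct is locally uniform convergence to infinity.\<close>

definition normally_convergent :: "complex set \<Rightarrow> (nat \<Rightarrow> complex \<Rightarrow> complex) \<Rightarrow> bool" where
  "normally_convergent U s \<longleftrightarrow>
     (\<exists>g. \<forall>K. compact K \<and> K \<subseteq> U \<longrightarrow> uniform_limit K s g sequentially) \<or>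
     (\<forall>K. compact K \<and> K \<subseteq> U \<longrightarrow>
        (\<forall>M::real. eventually (\<lambda>n. \<forall>z\<in>K. M \<le> norm (s n z)) sequentially))"

lemma normal_family_iff:
  "normal_family U F \<longleftrightarrow>
     (\<forall>s. (\<forall>n. s n \<in> F) \<longrightarrow> (\<exists>r::nat \<Rightarrow> nat. strict_mono r \<and> normally_convergent U (\<lambda>n. s (r n))))"
  unfolding normal_family_def normally_convergent_def ..

lemma normally_convergent_affine:
  assumes "normally_convergent U s" "c \<noteq> 0"
  shows "normally_convergent U (\<lambda>n z. p + c * s n z)"
proof -
  consider g where "\<And>K. compact K \<Longrightarrow> K \<subseteq> U \<Longrightarrow> uniform_limit K s g sequentially"
    | "\<And>K M. compact K \<Longrightarrow> K \<subseteq> U \<Longrightarrow> eventually (\<lambda>n. \<forall>z\<in>K. M \<le> norm (s n z)) sequentially"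
    using assms(1) unfolding normally_convergent_def by blast
  then show ?thesis
  proof cases
    case (1 g)
    have "uniform_limit K (\<lambda>n z. p + c * s n z) (\<lambda>z. p + c * g z) sequentially"
      if "compact K" "K \<subseteq> U" for K
      by (intro uniform_limit_intros 1 that)
    then show ?thesis unfolding normally_convergent_def by blast
  next
    case 2
    have "eventually (\<lambda>n. \<forall>z\<in>K. M \<le> norm (p + c * s n z)) sequentially"
      if "compact K" "K \<subseteq> U" for K M
      using 2[OF that, of "(M + norm p) / norm c"]
    proof (rule eventually_mono, intro ballI)
      fix n z assume "\<forall>z\<in>K. (M + norm p) / norm c \<le> norm (s n z)" "z \<in> K"
      then have "M + norm p \<le> norm (c * s n z)"
        using \<open>c \<noteq> 0\<close> by (auto simp: norm_mult field_simps)
      moreover have "norm (c * s n z) \<le> norm (p + c * s n z) + norm p"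
        by (metis add_diff_cancel_left' norm_triangle_sub add.commute norm_triangle_ineq4)
      ultimately show "M \<le> norm (p + c * s n z)" by linarith
    qed
    then show ?thesis unfolding normally_convergent_def by blast
  qed
qed

text \<open>By Hurwitz, a limit of zero-free holomorphic functions on a connected set is zero-free
  or identically zero. In the first case the reciprocals converge to the reciprocal of
  \<open>g\<close>; in the second they tend to infinity.\<close>

lemma normally_convergent_inverse:
  assumes S: "open S" "connected S"
    and hol: "\<And>n. s n holomorphic_on S" and nz: "\<And>n z. z \<in> S \<Longrightarrow> s n z \<noteq> 0"
    and holg: "g holomorphic_on S"
    and lim: "\<And>K. compact K \<Longrightarrow> K \<subseteq> S \<Longrightarrow> uniform_limit K s g sequentially"
  shows "normally_convergent S (\<lambda>n z. inverse (s n z))"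
proof (cases "\<exists>z\<in>S. g z = 0")
  case False
  have "uniform_limit K (\<lambda>n z. inverse (s n z)) (inverse \<circ> g) sequentially"
    if K: "compact K" "K \<subseteq> S" for K
  proof (cases "K = {}")
    case False
    have "continuous_on K (\<lambda>z. norm (g z))"
      using holg K by (intro continuous_intros holomorphic_on_imp_continuous_on)
        (blast intro: holomorphic_on_subset)
    then obtain x where x: "x \<in> K" "\<And>y. y \<in> K \<Longrightarrow> norm (g x) \<le> norm (g y)"
      using continuous_attains_inf[OF K(1) False] by blast
    show ?thesis
      by (rule uniform_lim_inverse[OF lim[OF K], where b = "norm (g x)"])
        (use x False K \<open>\<not> (\<exists>z\<in>S. g z = 0)\<close> in auto)
  qed auto
  then show ?thesis unfolding normally_convergent_def by blast
next
  case True
  then obtain v where v: "v \<in> S" "g v = 0" by blast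
  have "g constant_on S"
    using Hurwitz_no_zeros[OF S hol holg lim _ nz v(1)] v(2) by blast
  then have g0: "g z = 0" if "z \<in> S" for z
    using v that unfolding constant_on_def by metis
  have "eventually (\<lambda>n. \<forall>z\<in>K. M \<le> norm (inverse (s n z))) sequentially"
    if K: "compact K" "K \<subseteq> S" for K M
  proof -
    have "eventually (\<lambda>n. \<forall>z\<in>K. dist (s n z) (g z) < inverse (\<bar>M\<bar> + 1)) sequentially"
      by (intro uniform_limitD[OF lim[OF K]]) auto
    then show ?thesis
    proof (rule eventually_mono, intro ballI)
      fix n z assume *: "\<forall>z\<in>K. dist (s n z) (g z) < inverse (\<bar>M\<bar> + 1)" "z \<in> K"
      then have "norm (s n z) < inverse (\<bar>M\<bar> + 1)" "norm (s n z) > 0"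
        using K g0[of z] nz[of z] by (auto simp: subset_iff)
      then have "inverse (inverse (\<bar>M\<bar> + 1)) < inverse (norm (s n z))"
        using less_imp_inverse_less by blast
      then show "M \<le> norm (inverse (s n z))" by (simp add: norm_inverse)
    qed
  qed
  then show ?thesis unfolding normally_convergent_def by blast
qed

text \<open>At a base point \<open>w\<close>, infinitely many terms have modulus at most 1 or
  infinitely many have modulus at least 1. The first case reduces to Montel's theorem for locally
  bounded families; the second does too after taking reciprocals, which again omit 0 and 1.\<close>

lemma Montel_omitting_0_1:
  assumes S: "open S" "connected S"
    and hol: "\<And>n. s n holomorphic_on S"
    and om: "\<And>n z. z \<in> S \<Longrightarrow> s n z \<noteq> 0 \<and> s n z \<noteq> 1"
  shows "\<exists>r::nat \<Rightarrow> nat. strict_mono r \<and> normally_convergent S (\<lambda>n. s (r n))"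
proof (cases "S = {}")
  case True
  then show ?thesis
    by (intro exI[of _ id]) (auto simp: strict_mono_def normally_convergent_def)
next
  case False
  then obtain w where w: "w \<in> S" by blast
  define X where "X = {u. u holomorphic_on S \<and> (\<forall>z\<in>S. u z \<noteq> 0 \<and> u z \<noteq> 1)}"
  have key: "\<exists>(r::nat \<Rightarrow> nat) g. strict_mono r \<and> g holomorphic_on S \<and>
      (\<forall>K. compact K \<and> K \<subseteq> S \<longrightarrow> uniform_limit K (\<lambda>n. t (r n)) g sequentially)"
    if t: "\<And>n. t n \<in> X" "\<And>n. norm (t n w) \<le> 1" for t :: "nat \<Rightarrow> complex \<Rightarrow> complex"
  proof -
    have bd: "\<exists>B. \<forall>u\<in>range t. \<forall>z\<in>K. norm (u z) \<le> B" if K: "compact K" "K \<subseteq> S" for K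
    proof -
      obtain B where "\<And>u z. u \<in> range t \<Longrightarrow> z \<in> K \<Longrightarrow> norm (u z) \<le> B"
        \<comment> \<open>For functions omitting 0 and 1, a common bound at the single point
          \<open>w\<close> spreads to every compact subset of the connected set
          \<open>S\<close>.\<close>
        by (rule GPicard3[OF S w, of "range t" X K]) (use t K X_def in auto)
      then show ?thesis by blast
    qed
    obtain g r where "g holomorphic_on S" "strict_mono (r::nat \<Rightarrow> nat)"
      "\<And>K. compact K \<Longrightarrow> K \<subseteq> S \<Longrightarrow> uniform_limit K (t \<circ> r) g sequentially"
      by (rule Montel[OF S(1) _ bd, of t]) (use t X_def in auto)
    then show ?thesis unfolding comp_def by blast
  qed
  consider "infinite {n. norm (s n w) \<le> 1}" | "infinite {n. 1 \<le> norm (s n w)}"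
    by (metis (mono_tags, lifting) infinite_nat_iff_unbounded_le le_cases mem_Collect_eq)
  then show ?thesis
  proof cases
    case 1
    then obtain r :: "nat \<Rightarrow> nat" where r: "strict_mono r" "\<And>n. norm (s (r n) w) \<le> 1"
      using infinite_enumerate[OF 1] by blast
    have sX: "s (r n) \<in> X" for n
      using hol om by (auto simp: X_def)
    obtain r' :: "nat \<Rightarrow> nat" and g where r': "strict_mono r'"
      "\<And>K. compact K \<Longrightarrow> K \<subseteq> S \<Longrightarrow> uniform_limit K (\<lambda>n. s (r (r' n))) g sequentially"
      using key[of "\<lambda>n. s (r n)", OF sX r(2)] by blast
    then show ?thesis
      using strict_mono_o[OF r(1) r'(1)] unfolding normally_convergent_def comp_def
      by (intro exI[of _ "\<lambda>n. r (r' n)"]) blast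
  next
    case 2
    then obtain r :: "nat \<Rightarrow> nat" where r: "strict_mono r" "\<And>n. 1 \<le> norm (s (r n) w)"
      using infinite_enumerate[OF 2] by blast
    define t where "t = (\<lambda>n z. inverse (s (r n) z))"
    have tX: "t n \<in> X" for n
      unfolding X_def t_def using om hol by (auto intro!: holomorphic_intros)
    have t1: "norm (t n w) \<le> 1" for n
      using r(2)[of n] by (simp add: t_def norm_inverse inverse_le_1_iff)
    obtain r' :: "nat \<Rightarrow> nat" and g where r': "strict_mono r'" "g holomorphic_on S"
      "\<And>K. compact K \<Longrightarrow> K \<subseteq> S \<Longrightarrow> uniform_limit K (\<lambda>n. t (r' n)) g sequentially"
      using key[of t, OF tX t1] by blast
    have "normally_convergent S (\<lambda>n z. inverse (t (r' n) z))"
      by (rule normally_convergent_inverse[OF S _ _ r'(2,3)])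
        (use om hol in \<open>auto simp: t_def intro!: holomorphic_intros\<close>)
    then have "normally_convergent S (\<lambda>n. s (r (r' n)))"
      by (simp add: t_def)
    with strict_mono_o[OF r(1) r'(1)] show ?thesis
      unfolding comp_def by blast
  qed
qed

theorem Montel_omitting_two_values:
  assumes "open S" "connected S" "p \<noteq> q"
    and hol: "\<And>n. s n holomorphic_on S"
    and om: "\<And>n z. z \<in> S \<Longrightarrow> s n z \<noteq> p \<and> s n z \<noteq> q"
  shows "\<exists>r::nat \<Rightarrow> nat. strict_mono r \<and> normally_convergent S (\<lambda>n. s (r n))"
proof -
  \<comment> \<open>The affine change of coordinates carries \<open>p\<close> and \<open>q\<close>
    to 0 and 1.\<close>
  define u where "u = (\<lambda>n z. (s n z - p) / (q - p))"
  have "u n holomorphic_on S" for n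
    unfolding u_def using hol \<open>p \<noteq> q\<close> by (auto intro!: holomorphic_intros)
  moreover have "u n z \<noteq> 0 \<and> u n z \<noteq> 1" if "z \<in> S" for n z
    using om[OF that, of n] \<open>p \<noteq> q\<close> by (auto simp: u_def)
  ultimately obtain r :: "nat \<Rightarrow> nat" where r: "strict_mono r" "normally_convergent S (\<lambda>n. u (r n))"
    using Montel_omitting_0_1[OF assms(1,2)] by blast
  have "normally_convergent S (\<lambda>n z. p + (q - p) * u (r n) z)"
    by (rule normally_convergent_affine[OF r(2)]) (use \<open>p \<noteq> q\<close> in auto)
  moreover have "p + (q - p) * u n z = s n z" for n z
    using \<open>p \<noteq> q\<close> by (simp add: u_def)
  ultimately show ?thesis using r(1) by auto
qed

section \<open>Growth of iterates of non-affine entire functions\<close>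

text \<open>Constants are included through \<open>a = 0\<close>.\<close>

definition affine_map :: "(complex \<Rightarrow> complex) \<Rightarrow> bool" where
  "affine_map h \<longleftrightarrow> (\<exists>a b. \<forall>z. h z = a * z + b)"

section \<open>Entire functions of linear growth\<close>

lemma DERIV_zero_imp_constant:
  fixes k :: "complex \<Rightarrow> complex"
  assumes "\<And>z. (k has_field_derivative 0) (at z)"
  shows "k z = k w"
proof -
  have "continuous_on UNIV k"
    using assms by (meson DERIV_isCont continuous_at_imp_continuous_on)
  then obtain c where "\<And>z. k z = c"
    using DERIV_zero_connected_constant[of UNIV "{}" k] assms by auto
  then show ?thesis by simp
qed

lemma affine_map_if_deriv_constant:
  assumes "h holomorphic_on UNIV" "\<And>z. deriv h z = c"
  shows "affine_map h"
proof -
  have "((\<lambda>z. h z - c * z) has_field_derivative 0) (at z)" for z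
    using holomorphic_derivI[OF assms(1) open_UNIV, of z] assms(2)
    by (auto intro!: derivative_eq_intros)
  then have "h z - c * z = h 0 - c * 0" for z
    by (rule DERIV_zero_imp_constant)
  then have "h z = c * z + h 0" for z
    by (metis add.commute diff_add_cancel mult_zero_right diff_zero)
  then show ?thesis unfolding affine_map_def by blast
qed

text \<open>Cauchy's estimate on the circle of radius \<open>R / 4\<close> about \<open>z\<close>
  gives \<open>norm (h'' z) \<le> 32 * C / R\<close>. Letting \<open>R\<close> grow through the
  available radii forces the second derivative to vanish.\<close>

lemma affine_map_if_linear_growth_unbounded_radii:
  assumes hol: "h holomorphic_on UNIV"
    and growth: "\<And>R0. \<exists>R\<ge>R0. \<forall>z. norm z \<le> R / 2 \<longrightarrow> norm (h z) \<le> C * R"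
  shows "affine_map h"
proof (rule affine_map_if_deriv_constant[OF hol])
  have d2: "(deriv ^^ 2) h z = 0" for z
  proof (rule ccontr)
    assume "(deriv ^^ 2) h z \<noteq> 0"
    define d where "d = norm ((deriv ^^ 2) h z)"
    have "d > 0" using \<open>(deriv ^^ 2) h z \<noteq> 0\<close> by (simp add: d_def)
    \<comment> \<open>The term \<open>4 * norm z\<close> keeps the circle of radius
      \<open>R / 4\<close> about \<open>z\<close> inside the disc of radius \<open>R / 2\<close>;
      the last term makes \<open>d * R\<close> exceed the bound \<open>32 * C\<close> from Cauchy's
      estimate.\<close>
    obtain R where R: "R \<ge> 1 + 4 * norm z + 33 * \<bar>C\<bar> / d"
      and bd: "\<And>z. norm z \<le> R / 2 \<Longrightarrow> norm (h z) \<le> C * R"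
      using growth by blast
    have "0 \<le> 33 * \<bar>C\<bar> / d" using \<open>d > 0\<close> by simp
    then have "R \<ge> 1" "4 * norm z \<le> R" "33 * \<bar>C\<bar> / d < R" using R norm_ge_zero[of z] by linarith+
    have "norm ((deriv ^^ 2) h z) \<le> fact 2 * (C * R) / (R / 4) ^ 2"
    proof (rule Cauchy_inequality)
      fix x assume "norm (z - x) = R / 4"
      moreover have "norm x \<le> norm z + norm (z - x)"
        by (metis norm_minus_commute norm_triangle_sub)
      ultimately have "norm x \<le> R / 2"
        using \<open>4 * norm z \<le> R\<close> by linarith
      then show "norm (h x) \<le> C * R" by (rule bd)
    qed (use hol \<open>R \<ge> 1\<close> in \<open>auto intro: holomorphic_on_subset holomorphic_on_imp_continuous_on\<close>)
    also have "\<dots> = 32 * C / R"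
      using \<open>R \<ge> 1\<close> by (simp add: power2_eq_square field_simps)
    finally have "d * R \<le> 32 * C"
      using \<open>R \<ge> 1\<close> by (simp add: d_def field_simps)
    moreover have "33 * \<bar>C\<bar> < d * R"
      using \<open>33 * \<bar>C\<bar> / d < R\<close> \<open>d > 0\<close> by (simp add: field_simps)
    ultimately show False by linarith
  qed
  have "(deriv h has_field_derivative 0) (at z)" for z
  proof -
    have "(deriv h has_field_derivative deriv (deriv h) z) (at z)"
      by (rule holomorphic_derivI[OF holomorphic_deriv[OF hol open_UNIV] open_UNIV]) auto
    then show ?thesis using d2[of z] by (simp add: numeral_2_eq_2)
  qed
  then show "deriv h z = deriv h 0" for z
    by (rule DERIV_zero_imp_constant)
qed

text \<open>If the image of the disc of radius \<open>R\<close> missed points \<open>a\<close>, \<open>b\<close> of moduli \<open>2 R\<close> and \<open>4 R\<close>,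
  then Schottky's theorem for \<open>(h (R z) - a) / (b - a)\<close> would bound \<open>h\<close> on the half disc by a
  constant multiple of \<open>R\<close>.\<close>

lemma sphere_subset_image_cball:
  assumes hol: "h holomorphic_on UNIV" and na: "\<not> affine_map h"
  obtains R0 where "R0 > 0" "\<And>R. R \<ge> R0 \<Longrightarrow> \<exists>\<rho>\<ge>2 * R. sphere 0 \<rho> \<subseteq> h ` cball 0 R"
proof -
  \<comment> \<open>Schottky's bound on the disc of radius 1/2 for a function on the unit disc that
    omits 0 and 1 and has modulus at most 2 at the centre.\<close>
  define B where "B = exp (pi * exp (pi * (2 + 2 * 2 + 12 * (1/2) / (1 - 1/2))))"
  have "\<exists>R0>0. \<forall>R\<ge>R0. \<exists>\<rho>\<ge>2 * R. sphere 0 \<rho> \<subseteq> h ` cball 0 R"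
  proof (rule ccontr)
    assume *: "\<not> ?thesis"
    have "\<exists>R\<ge>R0. \<forall>z. norm z \<le> R / 2 \<longrightarrow> norm (h z) \<le> (2 + 6 * B) * R" for R0
    proof -
      have "max R0 (1 + norm (h 0)) > 0" by (smt (verit) norm_ge_zero)
      then obtain R where R: "R \<ge> max R0 (1 + norm (h 0))"
        and miss: "\<And>\<rho>. \<rho> \<ge> 2 * R \<Longrightarrow> \<not> sphere 0 \<rho> \<subseteq> h ` cball 0 R"
        using * by blast
      have "R > 0" "norm (h 0) \<le> R" "R \<ge> R0" using R norm_ge_zero[of "h 0"] by linarith+
      obtain a where a: "norm a = 2 * R" "a \<notin> h ` cball 0 R"
        using miss[of "2 * R"] by (auto simp: subset_iff)
      obtain b where b: "norm b = 4 * R" "b \<notin> h ` cball 0 R"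
        using miss[of "4 * R"] \<open>R > 0\<close> by (auto simp: subset_iff)
      \<comment> \<open>With \<open>norm (h 0) \<le> R\<close>, the lower bound yields
        \<open>norm (u 0) \<le> 3 / 2\<close>. The upper bound produces the constant
        \<open>2 + 6 * B\<close>, since \<open>norm (h z)\<close> is at most
        \<open>norm a + B * norm (b - a)\<close>.\<close>
      have ab: "2 * R \<le> norm (b - a)" "norm (b - a) \<le> 6 * R"
        using norm_triangle_ineq2[of b a] norm_triangle_ineq4[of b a] a b by auto
      define u where "u = (\<lambda>z. (h (of_real R * z) - a) / (b - a))"
      have "norm (h z) \<le> (2 + 6 * B) * R" if z: "norm z \<le> R / 2" for z
      proof -
        have "norm (u (z / of_real R)) \<le> B"
          unfolding B_def
        proof (rule Schottky[of u 2 "1/2" "z / of_real R"])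
          show "u holomorphic_on cball 0 1"
            unfolding u_def using ab \<open>R > 0\<close>
            by (intro holomorphic_intros holomorphic_on_compose_gen[unfolded o_def, OF _ hol]) auto
          have "norm (h 0 - a) \<le> 3 * R"
            using norm_triangle_ineq4[of "h 0" a] a \<open>norm (h 0) \<le> R\<close> by linarith
          then have "norm (h 0 - a) \<le> 2 * norm (b - a)"
            using ab \<open>R > 0\<close> by linarith
          then show "norm (u 0) \<le> 2"
            using ab \<open>R > 0\<close> by (simp add: u_def norm_divide divide_le_eq)
          show "\<not> (u x = 0 \<or> u x = 1)" if "x \<in> cball 0 1" for x
          proof -
            have "of_real R * x \<in> cball 0 R"
              using that \<open>R > 0\<close> by (simp add: norm_mult)
            then have "h (of_real R * x) \<noteq> a" "h (of_real R * x) \<noteq> b"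
              using a b by blast+
            moreover have "b \<noteq> a" using ab \<open>R > 0\<close> by auto
            ultimately show ?thesis by (auto simp: u_def)
          qed
          show "norm (z / of_real R) \<le> 1 / 2"
            using z \<open>R > 0\<close> by (simp add: norm_divide field_simps)
        qed auto
        then have "norm (h z - a) \<le> B * norm (b - a)"
          using ab \<open>R > 0\<close> by (simp add: u_def norm_divide divide_le_eq split: if_splits)
        also have "\<dots> \<le> B * (6 * R)"
          using ab by (intro mult_left_mono) (auto simp: B_def)
        finally show ?thesis
          using norm_triangle_sub[of "h z" a] a by (simp add: algebra_simps)
      qed
      then show ?thesis using \<open>R \<ge> R0\<close> by blast
    qed
    then show False
      using affine_map_if_linear_growth_unbounded_radii[OF hol] na by blast
  qed
  then show ?thesis using that by blast
qed

section \<open>Exponential growth of iterates on large circles\<close>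

lemma holomorphic_on_funpow:
  "h holomorphic_on UNIV \<Longrightarrow> (h ^^ n) holomorphic_on S"
proof (induction n arbitrary: S)
  case (Suc n)
  then show ?case
    unfolding funpow.simps
    by (blast intro: holomorphic_on_compose holomorphic_on_subset)
qed (auto simp: id_def)

text \<open>The image of the disc of radius \<open>R\<close> contains a circle of radius at least
  \<open>2 * R\<close>, on which the previous iterate is already large by induction; each step gains
  a factor 2.\<close>

lemma iterate_large_on_sphere:
  assumes hol: "h holomorphic_on UNIV" and na: "\<not> affine_map h"
  obtains R0 where "R0 > 0" "\<And>R n. R \<ge> R0 \<Longrightarrow> \<exists>z\<in>sphere 0 R. 2 ^ n * R \<le> norm ((h ^^ n) z)"
proof -
  obtain R0 where R0: "R0 > 0" "\<And>R. R \<ge> R0 \<Longrightarrow> \<exists>\<rho>\<ge>2 * R. sphere 0 \<rho> \<subseteq> h ` cball 0 R"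
    using sphere_subset_image_cball[OF assms] by blast
  have "\<exists>z\<in>sphere 0 R. 2 ^ n * R \<le> norm ((h ^^ n) z)" if "R \<ge> R0" for R n
    using that
  proof (induction n arbitrary: R)
    case 0
    obtain z :: complex where "norm z = R"
      using R0 0 by (metis norm_of_real abs_of_pos less_le_trans)
    then show ?case by auto
  next
    case (Suc n)
    have "R > 0" using R0 Suc.prems by linarith
    obtain \<rho> where \<rho>: "\<rho> \<ge> 2 * R" "sphere 0 \<rho> \<subseteq> h ` cball 0 R"
      using R0 Suc.prems by blast
    have "\<rho> \<ge> R0" using \<rho> R0 Suc.prems by linarith
    then obtain w where w: "w \<in> sphere 0 \<rho>" "2 ^ n * \<rho> \<le> norm ((h ^^ n) w)"
      using Suc.IH by blast
    then obtain x where x: "x \<in> cball 0 R" "w = h x" using \<rho> by blast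
    have "2 ^ Suc n * R \<le> 2 ^ n * \<rho>" using \<rho> by simp
    also have "\<dots> \<le> norm ((h ^^ Suc n) x)"
      using w x by (simp add: funpow_Suc_right del: funpow.simps)
    finally have big: "2 ^ Suc n * R \<le> norm ((h ^^ Suc n) x)" .
    have cont: "continuous_on A (\<lambda>z. norm ((h ^^ Suc n) z))" for A
      by (intro continuous_intros holomorphic_on_imp_continuous_on holomorphic_on_funpow hol)
    \<comment> \<open>The point \<open>x\<close> is only known to lie in the disc; the maximum
      principle replaces it by a point of the circle.\<close>
    obtain y where y: "y \<in> sphere 0 R" "\<And>z. z \<in> sphere 0 R \<Longrightarrow> norm ((h ^^ Suc n) z) \<le> norm ((h ^^ Suc n) y)"
      using continuous_attains_sup[OF compact_sphere _ cont, of 0 R] \<open>R > 0\<close> by auto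
    have "norm ((h ^^ Suc n) x) \<le> norm ((h ^^ Suc n) y)"
      by (rule maximum_modulus_frontier[of _ "cball 0 R"])
        (use x y \<open>R > 0\<close> in \<open>auto simp del: funpow.simps
          intro: holomorphic_on_funpow hol holomorphic_on_imp_continuous_on\<close>)
    with big y(1) show ?case by (meson order_trans)
  qed
  with R0(1) show ?thesis using that by blast
qed

section \<open>The Julia set has two points\<close>

lemma fatou_set_subsequence:
  assumes "z \<in> fatou_set h"
  obtains e where "e > 0"
    "\<And>n::nat \<Rightarrow> nat. \<exists>r::nat \<Rightarrow> nat. strict_mono r \<and>
       ((\<exists>g. uniform_limit (cball z e) (\<lambda>k. h ^^ n (r k)) g sequentially) \<or>
        (\<forall>M::real. \<forall>\<^sub>F k in sequentially. \<forall>w\<in>cball z e. M \<le> norm ((h ^^ n (r k)) w)))"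
proof -
  obtain U where U: "open U" "z \<in> U" "normal_family U (range (\<lambda>n. h ^^ n))"
    using assms unfolding fatou_set_def by blast
  then obtain e where e: "e > 0" "cball z e \<subseteq> U"
    using open_contains_cball_eq by blast
  show ?thesis
  proof (rule that[OF e(1)])
    \<comment> \<open>The exponents are arbitrary, possibly repeating, so that they can later be
      chosen to witness unboundedness.\<close>
    fix n :: "nat \<Rightarrow> nat"
    obtain r :: "nat \<Rightarrow> nat" where r: "strict_mono r" "normally_convergent U (\<lambda>k. h ^^ n (r k))"
      using U(3)[unfolded normal_family_iff, rule_format, of "\<lambda>k. h ^^ n k"] by auto
    have K: "compact (cball z e) \<and> cball z e \<subseteq> U" using e by simp
    have "(\<exists>g. uniform_limit (cball z e) (\<lambda>k. h ^^ n (r k)) g sequentially) \<or>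
        (\<forall>M::real. \<forall>\<^sub>F k in sequentially. \<forall>w\<in>cball z e. M \<le> norm ((h ^^ n (r k)) w))"
      using r(2) unfolding normally_convergent_def
    proof (elim disjE exE)
      fix g assume "\<forall>K. compact K \<and> K \<subseteq> U \<longrightarrow> uniform_limit K (\<lambda>k. h ^^ n (r k)) g sequentially"
      from this[rule_format, OF K] show ?thesis by blast
    next
      assume *: "\<forall>K. compact K \<and> K \<subseteq> U \<longrightarrow>
        (\<forall>M. \<forall>\<^sub>F k in sequentially. \<forall>w\<in>K. M \<le> norm ((h ^^ n (r k)) w))"
      show ?thesis by (rule disjI2) (use * K in simp)
    qed
    with r(1) show "\<exists>r::nat \<Rightarrow> nat. strict_mono r \<and>
       ((\<exists>g. uniform_limit (cball z e) (\<lambda>k. h ^^ n (r k)) g sequentially) \<or>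
        (\<forall>M::real. \<forall>\<^sub>F k in sequentially. \<forall>w\<in>cball z e. M \<le> norm ((h ^^ n (r k)) w)))"
      by (intro exI[of _ r] conjI)
  qed
qed

lemma uniform_limit_compact_bounded:
  fixes s :: "nat \<Rightarrow> complex \<Rightarrow> complex"
  assumes "uniform_limit K s g sequentially" "compact K" "\<And>n. continuous_on K (s n)"
  obtains B where "\<And>z. z \<in> K \<Longrightarrow> norm (g z) \<le> B"
    "\<forall>\<^sub>F n in sequentially. \<forall>z\<in>K. norm (s n z) \<le> B"
proof -
  have "continuous_on K g"
    by (rule uniform_limit_theorem[OF _ assms(1)]) (use assms(3) in auto)
  then have "bounded (g ` K)"
    using assms(2) compact_continuous_image compact_imp_bounded by blast
  then obtain B where B: "\<And>z. z \<in> K \<Longrightarrow> norm (g z) \<le> B"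
    unfolding bounded_iff by blast
  have "\<forall>\<^sub>F n in sequentially. \<forall>z\<in>K. dist (s n z) (g z) < 1"
    by (rule uniform_limitD[OF assms(1)]) auto
  then have "\<forall>\<^sub>F n in sequentially. \<forall>z\<in>K. norm (s n z) \<le> B + 1"
  proof (rule eventually_mono, intro ballI)
    fix n z assume "\<forall>z\<in>K. dist (s n z) (g z) < 1" "z \<in> K"
    then show "norm (s n z) \<le> B + 1"
      using B[of z] norm_triangle_sub[of "s n z" "g z"] by (fastforce simp: dist_norm)
  qed
  then show ?thesis using that[of "B + 1"] B by fastforce
qed

lemma not_uniform_limit_if_unbounded:
  fixes s :: "nat \<Rightarrow> complex \<Rightarrow> complex"
  assumes "compact K" "\<And>n. continuous_on K (s n)"
    and w: "\<And>n. w n \<in> K" "\<And>n. real n < norm (s n (w n))"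
  shows "\<not> uniform_limit K s g sequentially"
proof
  assume "uniform_limit K s g sequentially"
  then obtain B where "\<forall>\<^sub>F n in sequentially. \<forall>z\<in>K. norm (s n z) \<le> B"
    by (rule uniform_limit_compact_bounded) (use assms(1,2) in auto)
  then obtain N where N: "\<And>n. n \<ge> N \<Longrightarrow> \<forall>z\<in>K. norm (s n z) \<le> B"
    unfolding eventually_sequentially by blast
  obtain m :: nat where m: "B < real m"
    using reals_Archimedean2 by blast
  define n where "n = max N m"
  have "norm (s n (w n)) \<le> B" "real m \<le> real n"
    using N[of n] w(1)[of n] by (auto simp: n_def)
  with m w(2)[of n] show False by linarith
qed

text \<open>Without a uniform bound, some iterates would exceed every \<open>k\<close> somewhere in
  the disc. No subsequence of these has a finite uniform limit, and none tends to infinity, because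
  the orbit of the centre is bounded.\<close>

lemma fatou_set_bounded_orbit_nhd:
  assumes hol: "h holomorphic_on UNIV" and z: "z \<in> fatou_set h"
    and bdd: "bounded (range (\<lambda>n. (h ^^ n) z))"
  obtains e B where "e > 0" "\<And>n w. w \<in> ball z e \<Longrightarrow> norm ((h ^^ n) w) \<le> B"
proof -
  have conth: "continuous_on A (h ^^ n)" for A n
    by (intro holomorphic_on_imp_continuous_on holomorphic_on_funpow hol)
  obtain e where e: "e > 0" and sub: "\<And>n::nat \<Rightarrow> nat. \<exists>r::nat \<Rightarrow> nat. strict_mono r \<and>
       ((\<exists>g. uniform_limit (cball z e) (\<lambda>k. h ^^ n (r k)) g sequentially) \<or>
        (\<forall>M::real. \<forall>\<^sub>F k in sequentially. \<forall>w\<in>cball z e. M \<le> norm ((h ^^ n (r k)) w)))"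
    using fatou_set_subsequence[OF z] by blast
  have "\<exists>B. \<forall>n. \<forall>w\<in>ball z e. norm ((h ^^ n) w) \<le> B"
  proof (rule ccontr)
    assume "\<not> ?thesis"
    then have "\<forall>k::nat. \<exists>n w. w \<in> ball z e \<and> real k < norm ((h ^^ n) w)"
      by (meson not_le)
    then obtain n w where nw: "\<And>k::nat. w k \<in> ball z e" "\<And>k. real k < norm ((h ^^ n k) (w k))"
      by metis
    obtain r :: "nat \<Rightarrow> nat" where r: "strict_mono r"
      and alt: "(\<exists>g. uniform_limit (cball z e) (\<lambda>k. h ^^ n (r k)) g sequentially) \<or>
        (\<forall>M::real. \<forall>\<^sub>F k in sequentially. \<forall>w\<in>cball z e. M \<le> norm ((h ^^ n (r k)) w))"
      using sub[of n] by blast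
    show False
      using alt
    proof (elim disjE exE)
      \<comment> \<open>Since \<open>k \<le> r k\<close>, the lower bound survives the passage to
        the subsequence.\<close>
      have "real k < norm ((h ^^ n (r k)) (w (r k)))" for k
        using nw(2)[of "r k"] seq_suble[OF r, of k] by linarith
      moreover have "w (r k) \<in> cball z e" for k
        using nw(1)[of "r k"] by simp
      moreover fix g assume "uniform_limit (cball z e) (\<lambda>k. h ^^ n (r k)) g sequentially"
      ultimately show False
        using not_uniform_limit_if_unbounded[OF compact_cball, of z e "\<lambda>k. h ^^ n (r k)" "\<lambda>k. w (r k)" g] conth by blast
    next
      obtain B where B: "\<And>n. norm ((h ^^ n) z) \<le> B"
        using bdd unfolding bounded_iff by blast
      assume "\<forall>M::real. \<forall>\<^sub>F k in sequentially. \<forall>w\<in>cball z e. M \<le> norm ((h ^^ n (r k)) w)"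
      then have "\<forall>\<^sub>F k in sequentially. \<forall>w\<in>cball z e. B + 1 \<le> norm ((h ^^ n (r k)) w)"
        by blast
      then obtain k where "\<forall>w\<in>cball z e. B + 1 \<le> norm ((h ^^ n (r k)) w)"
        by (auto simp: eventually_sequentially)
      then have "B + 1 \<le> norm ((h ^^ n (r k)) z)" using e by simp
      then show False using B[of "n (r k)"] by linarith
    qed
  qed
  then show ?thesis using that e by blast
qed

text \<open>Iterates that blow up at \<open>z\<close> have no finite uniform limit near
  \<open>z\<close>, so by normality a subsequence tends to infinity on a whole disc.\<close>

lemma fatou_set_unbounded_orbit_nhd:
  assumes hol: "h holomorphic_on UNIV" and z: "z \<in> fatou_set h"
    and unb: "\<not> bounded (range (\<lambda>n. (h ^^ n) z))"
  obtains e where "e > 0" "\<And>w. w \<in> ball z e \<Longrightarrow> \<not> bounded (range (\<lambda>n. (h ^^ n) w))"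
proof -
  have conth: "continuous_on A (h ^^ n)" for A n
    by (intro holomorphic_on_imp_continuous_on holomorphic_on_funpow hol)
  obtain e where e: "e > 0" and sub: "\<And>n::nat \<Rightarrow> nat. \<exists>r::nat \<Rightarrow> nat. strict_mono r \<and>
       ((\<exists>g. uniform_limit (cball z e) (\<lambda>k. h ^^ n (r k)) g sequentially) \<or>
        (\<forall>M::real. \<forall>\<^sub>F k in sequentially. \<forall>w\<in>cball z e. M \<le> norm ((h ^^ n (r k)) w)))"
    using fatou_set_subsequence[OF z] by blast
  have "\<forall>k::nat. \<exists>n. real k < norm ((h ^^ n) z)"
    using unb unfolding bounded_iff by (metis (mono_tags, lifting) not_le rangeE)
  then obtain n where n: "\<And>k::nat. real k < norm ((h ^^ n k) z)" by metis
  obtain r :: "nat \<Rightarrow> nat" where r: "strict_mono r"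
    and alt: "(\<exists>g. uniform_limit (cball z e) (\<lambda>k. h ^^ n (r k)) g sequentially) \<or>
      (\<forall>M::real. \<forall>\<^sub>F k in sequentially. \<forall>w\<in>cball z e. M \<le> norm ((h ^^ n (r k)) w))"
    using sub[of n] by blast
  have "\<nexists>g. uniform_limit (cball z e) (\<lambda>k. h ^^ n (r k)) g sequentially"
  proof -
    have "real k < norm ((h ^^ n (r k)) z)" for k
      using n[of "r k"] seq_suble[OF r, of k] by linarith
    moreover have "z \<in> cball z e" using e by simp
    ultimately show ?thesis
      using not_uniform_limit_if_unbounded[OF compact_cball, of z e "\<lambda>k. h ^^ n (r k)" "\<lambda>k. z"] conth by blast
  qed
  with alt have inf: "\<forall>\<^sub>F k in sequentially. \<forall>w\<in>cball z e. M \<le> norm ((h ^^ n (r k)) w)" for M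
    by blast
  show ?thesis
  proof (rule that[OF e])
    fix w assume w: "w \<in> ball z e"
    show "\<not> bounded (range (\<lambda>n. (h ^^ n) w))"
    proof
      assume "bounded (range (\<lambda>n. (h ^^ n) w))"
      then obtain B where B: "\<And>n. norm ((h ^^ n) w) \<le> B"
        unfolding bounded_iff by blast
      obtain k where "\<forall>w\<in>cball z e. B + 1 \<le> norm ((h ^^ n (r k)) w)"
        using inf[of "B + 1"] by (auto simp: eventually_sequentially)
      then have "B + 1 \<le> norm ((h ^^ n (r k)) w)" using w by simp
      then show False using B[of "n (r k)"] by linarith
    qed
  qed
qed

text \<open>Both boundedness and unboundedness of the orbit are open conditions within the Fatou
  set, so neither can change on a connected subset.\<close>

lemma bounded_orbit_iff_on_connected:
  assumes hol: "h holomorphic_on UNIV" and S: "connected S" "S \<subseteq> fatou_set h"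
    and "z \<in> S" "w \<in> S"
  shows "bounded (range (\<lambda>n. (h ^^ n) z)) \<longleftrightarrow> bounded (range (\<lambda>n. (h ^^ n) w))"
proof (rule connected_equivalence_relation[OF S(1) \<open>z \<in> S\<close> \<open>w \<in> S\<close>])
  fix a assume "a \<in> S"
  then have a: "a \<in> fatou_set h" using S by blast
  obtain e where e: "e > 0" and same:
    "\<And>x. x \<in> ball a e \<Longrightarrow> bounded (range (\<lambda>n. (h ^^ n) a)) \<longleftrightarrow> bounded (range (\<lambda>n. (h ^^ n) x))"
  proof (cases "bounded (range (\<lambda>n. (h ^^ n) a))")
    case True
    then obtain e B where "e > 0" "\<And>n w. w \<in> ball a e \<Longrightarrow> norm ((h ^^ n) w) \<le> B"
      using fatou_set_bounded_orbit_nhd[OF hol a] by metis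
    then have "bounded (range (\<lambda>n. (h ^^ n) x))" if "x \<in> ball a e" for x
      using that unfolding bounded_iff by blast
    then show ?thesis using that \<open>e > 0\<close> True by blast
  next
    case False
    then obtain e where "e > 0" "\<And>w. w \<in> ball a e \<Longrightarrow> \<not> bounded (range (\<lambda>n. (h ^^ n) w))"
      using fatou_set_unbounded_orbit_nhd[OF hol a] by metis
    then show ?thesis using that False by blast
  qed
  show "\<exists>T. openin (top_of_set S) T \<and> a \<in> T \<and>
    (\<forall>x\<in>T. bounded (range (\<lambda>n. (h ^^ n) a)) \<longleftrightarrow> bounded (range (\<lambda>n. (h ^^ n) x)))"
    using \<open>a \<in> S\<close> e same by (intro exI[of _ "S \<inter> ball a e"]) (auto intro: openin_open_Int)
qed auto

text \<open>The quotient is pulled back by \<open>a + exp z\<close>, so that Picard's little theorem applies although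
  \<open>h\<close> is controlled off \<open>a\<close> only.\<close>

lemma exists_preperiodic_point_ne:
  assumes hol: "h holomorphic_on UNIV" and na: "\<not> affine_map h"
  obtains z where "z \<noteq> a" "h z = z \<or> h (h z) = z \<or> h (h z) = h z"
proof -
  have False if no: "\<And>z. z \<noteq> a \<Longrightarrow> h z \<noteq> z \<and> h (h z) \<noteq> z \<and> h (h z) \<noteq> h z"
  proof -
    \<comment> \<open>A pole of \<open>q\<close> would need a fixed point of \<open>h\<close>, a
      zero a solution of \<open>h (h z) = z\<close>, and the value 1 a solution of
      \<open>h (h z) = h z\<close>; all three are excluded off \<open>a\<close>.\<close>
    define q where "q = (\<lambda>z. (h (h z) - z) / (h z - z))"
    have comp: "(\<lambda>z. h (u z)) holomorphic_on UNIV" if "u holomorphic_on UNIV" for u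
      using holomorphic_on_compose_gen[OF that hol] by (simp add: o_def)
    have "(\<lambda>z. q (a + exp z)) holomorphic_on UNIV"
      unfolding q_def using no by (intro holomorphic_intros comp) auto
    moreover have "q (a + exp z) \<noteq> 0 \<and> q (a + exp z) \<noteq> 1" for z
      using no[of "a + exp z"] by (auto simp: q_def)
    ultimately obtain c where c: "(\<lambda>z. q (a + exp z)) = (\<lambda>x. c)"
      by (rule little_Picard_01)
    have qc: "q z = c" if "z \<noteq> a" for z
      using fun_cong[OF c, of "Ln (z - a)"] that by simp
    have c01: "c \<noteq> 0" "c \<noteq> 1"
      using qc[of "a + 1"] no[of "a + 1"] by (auto simp: q_def)
    have eq0: "h (h z) - z - c * (h z - z) = 0" if "z \<noteq> a" for z
      using qc[OF that] no[OF that] by (simp add: q_def divide_eq_eq)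
    have eq: "h (h z) - z - c * (h z - z) = 0" for z
    proof (rule analytic_continuation[of "\<lambda>z. h (h z) - z - c * (h z - z)" UNIV "- {a}" a z])
      show "(\<lambda>z. h (h z) - z - c * (h z - z)) holomorphic_on UNIV"
        using hol by (intro holomorphic_intros comp)
      show "a islimpt - {a}"
        unfolding Compl_eq_Diff_UNIV islimpt_punctured[symmetric] by (rule islimpt_UNIV)
    qed (use eq0 in auto)
    have dh: "(h has_field_derivative deriv h z) (at z)" for z
      by (rule holomorphic_derivI[OF hol]) auto
    \<comment> \<open>This is the derivative of the identity
      \<open>h (h z) - z = c * (h z - z)\<close>, rearranged.\<close>
    have prod: "deriv h z * (deriv h (h z) - c) = 1 - c" for z
    proof -
      have "((\<lambda>z. h (h z) - z - c * (h z - z)) has_field_derivative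
          deriv h (h z) * deriv h z - 1 - c * (deriv h z - 1)) (at z)"
        by (rule derivative_eq_intros dh DERIV_chain2[of h _ h] refl | simp)+
      moreover have "((\<lambda>z. h (h z) - z - c * (h z - z)) has_field_derivative 0) (at z)"
        unfolding eq by simp
      ultimately have "deriv h (h z) * deriv h z - 1 - c * (deriv h z - 1) = 0"
        by (rule DERIV_unique)
      then show ?thesis by (simp add: algebra_simps)
    qed
    have hold: "deriv h holomorphic_on UNIV"
      by (rule holomorphic_deriv[OF hol]) auto
    \<comment> \<open>The right-hand side \<open>1 - c\<close> of \<open>prod\<close> is nonzero, so
      no factor vanishes: at \<open>z\<close> this excludes the value \<open>c\<close>, at
      \<open>h z\<close> the value 0. Picard's little theorem then makes the derivative of
      \<open>h\<close> constant along \<open>h\<close>, and \<open>prod\<close> makes it constant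
      everywhere.\<close>
    have "deriv h (h z) \<noteq> 0" "deriv h (h z) \<noteq> c" for z
      using prod[of z] prod[of "h z"] c01 by auto
    then have "range (\<lambda>z. deriv h (h z)) \<inter> {0, c} = {}"
      by force
    moreover have "(\<lambda>z. deriv h (h z)) holomorphic_on UNIV"
      using holomorphic_on_compose_gen[OF hol hold] by (simp add: o_def)
    ultimately obtain k where k: "(\<lambda>z. deriv h (h z)) = (\<lambda>x. k)"
      using little_Picard c01(1) by metis
    have "k \<noteq> c"
      using prod[of a] fun_cong[OF k, of a] c01 by auto
    then have "deriv h z = (1 - c) / (k - c)" for z
      using prod[of z] fun_cong[OF k, of z] by (simp add: field_simps)
    then show False
      using affine_map_if_deriv_constant[OF hol] na by blast
  qed
  then show ?thesis using that by blast
qed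

text \<open>A preperiodic point off \<open>a\<close> has a bounded orbit, and connectedness of the
  punctured plane makes every orbit off \<open>a\<close> bounded. By compactness all iterates are
  then uniformly bounded on a circle avoiding \<open>a\<close>, against their exponential growth
  there.\<close>

theorem julia_set_not_subset_singleton:
  assumes hol: "h holomorphic_on UNIV" and na: "\<not> affine_map h"
  shows "\<not> - {a} \<subseteq> fatou_set h"
proof
  assume sub: "- {a} \<subseteq> fatou_set h"
  obtain p where p: "p \<noteq> a" "h p = p \<or> h (h p) = p \<or> h (h p) = h p"
    using exists_preperiodic_point_ne[OF assms] by blast
  have "(h ^^ n) p \<in> {p, h p}" for n
    by (induction n) (use p in auto)
  then have "range (\<lambda>n. (h ^^ n) p) \<subseteq> {p, h p}"
    by blast
  then have "bounded (range (\<lambda>n. (h ^^ n) p))"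
    by (rule bounded_subset[rotated]) auto
  moreover have "connected (- {a})"
    by (rule connected_punctured_universe) simp
  ultimately have bdd: "bounded (range (\<lambda>n. (h ^^ n) z))" if "z \<noteq> a" for z
    using bounded_orbit_iff_on_connected[OF hol _ sub, of p z] p that by auto
  obtain R0 where R0: "R0 > 0" "\<And>R n. R \<ge> R0 \<Longrightarrow> \<exists>z\<in>sphere 0 R. 2 ^ n * R \<le> norm ((h ^^ n) z)"
    using iterate_large_on_sphere[OF assms] by blast
  \<comment> \<open>A radius above \<open>norm a\<close> keeps the circle away from the exceptional
    point.\<close>
  define R where "R = max R0 (norm a + 1)"
  have R: "R \<ge> R0" "R > norm a" "R > 0" using R0(1) by (auto simp: R_def)
  have "\<exists>e B. e > 0 \<and> (\<forall>n. \<forall>w\<in>ball z e. norm ((h ^^ n) w) \<le> B)" if "z \<in> sphere 0 R" for z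
  proof -
    have "z \<noteq> a" using that R by auto
    then show ?thesis
      using fatou_set_bounded_orbit_nhd[OF hol _ bdd[of z]] sub by (metis ComplI singletonD subsetD)
  qed
  then obtain e B where eB: "\<And>z. z \<in> sphere 0 R \<Longrightarrow> e z > 0"
    "\<And>z n w. z \<in> sphere 0 R \<Longrightarrow> w \<in> ball z (e z) \<Longrightarrow> norm ((h ^^ n) w) \<le> B z"
    by metis
  have "sphere 0 R \<subseteq> (\<Union>z\<in>sphere 0 R. ball z (e z))"
    using eB(1) by force
  then obtain D where D: "D \<subseteq> sphere 0 R" "finite D" "sphere 0 R \<subseteq> (\<Union>z\<in>D. ball z (e z))"
    using compactE_image[OF compact_sphere, of "sphere 0 R" "\<lambda>z. ball z (e z)" 0 R] by blast
  define M where "M = (\<Sum>z\<in>D. \<bar>B z\<bar>)"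
  have M: "norm ((h ^^ n) w) \<le> M" if w: "w \<in> sphere 0 R" for n w
  proof -
    obtain z where z: "z \<in> D" "w \<in> ball z (e z)" using D w by blast
    then have "norm ((h ^^ n) w) \<le> \<bar>B z\<bar>" using eB(2)[of z w n] D by force
    also have "\<dots> \<le> M" unfolding M_def using z D by (intro member_le_sum) auto
    finally show ?thesis .
  qed
  obtain n where n: "M / R < 2 ^ n"
    using real_arch_pow[of 2 "M / R"] by auto
  obtain z where "z \<in> sphere 0 R" "2 ^ n * R \<le> norm ((h ^^ n) z)"
    using R0(2)[OF R(1)] by blast
  with M[of z n] n R show False by (simp add: field_simps)
qed

section \<open>Permutable entire functions\<close>

lemma large_argument_if_large_value:
  assumes "continuous_on UNIV (g :: complex \<Rightarrow> complex)"
  obtains M' where "\<And>w. M' \<le> norm (g w) \<Longrightarrow> M \<le> norm w"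
proof -
  have "bounded (g ` cball 0 M)"
    using assms compact_continuous_image compact_imp_bounded compact_cball continuous_on_subset
    by (metis subset_UNIV)
  then obtain B where "\<forall>y\<in>g ` cball 0 M. norm y \<le> B"
    unfolding bounded_iff by blast
  then have B: "norm (g w) \<le> B" if "norm w \<le> M" for w
    using that by simp
  show ?thesis
  proof (rule that)
    fix w assume "B + 1 \<le> norm (g w)"
    then show "M \<le> norm w" using B[of w] by linarith
  qed
qed

text \<open>If the composition is constant, then \<open>f\<close> is constant on the open range of
  \<open>g\<close>, hence everywhere. If it is affine with \<open>a \<noteq> 0\<close>, then
  \<open>g\<close> tends to infinity at infinity, because \<open>f\<close> is bounded on discs; so
  \<open>g\<close> has a pole there and is a polynomial.\<close>

lemma transcendental_entire_comp_not_affine: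
  assumes f: "transcendental_entire f" and g: "transcendental_entire g"
  shows "\<not> affine_map (f \<circ> g)"
proof
  assume "affine_map (f \<circ> g)"
  then obtain a b where ab: "\<And>z. f (g z) = a * z + b"
    unfolding affine_map_def by auto
  have hol: "f holomorphic_on UNIV" "g holomorphic_on UNIV"
    using f g by (auto simp: transcendental_entire_def entire_def)
  have nonpoly: "\<not> (\<forall>z. f z = poly p z)" "\<not> (\<forall>z. g z = poly p z)" for p
    using f g by (auto simp: transcendental_entire_def)
  show False
  proof (cases "a = 0")
    case True
    have "\<not> g constant_on UNIV"
      using nonpoly(2)[of "[:c:]" for c] by (auto simp: constant_on_def)
    then have op: "open (range g)"
      using open_mapping_thm[OF hol(2)] by blast
    have "f z - b = 0" for z
    proof (rule analytic_continuation[of "\<lambda>z. f z - b" UNIV "range g" "g 0"])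
      show "g 0 islimpt range g"
        using op by (rule open_imp_islimpt) auto
    qed (use hol ab True in \<open>auto intro!: holomorphic_intros\<close>)
    then show False using nonpoly(1)[of "[:b:]"] by auto
  next
    case False
    have "filterlim g at_infinity at_infinity"
      unfolding filterlim_at_infinity[OF order_refl]
    proof (intro allI impI)
      fix M :: real assume "M > 0"
      obtain M' where M': "\<And>w. M' \<le> norm (f w) \<Longrightarrow> M \<le> norm w"
        using large_argument_if_large_value[OF holomorphic_on_imp_continuous_on[OF hol(1)]] by blast
      have "M \<le> norm (g z)" if z: "norm z \<ge> (M' + norm b) / norm a" for z
      proof (rule M')
        have "norm (a * z) \<ge> M' + norm b"
          using z False by (simp add: norm_mult field_simps)
        then show "M' \<le> norm (f (g z))"
          using norm_triangle_ineq4[of "a * z + b" b] by (simp add: ab)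
      qed
      then show "\<forall>\<^sub>F z in at_infinity. M \<le> norm (g z)"
        unfolding eventually_at_infinity by blast
    qed
    then have "((inverse \<circ> g) \<longlongrightarrow> 0) at_infinity"
      unfolding comp_def by (rule filterlim_compose[OF tendsto_inverse_0])
    then obtain c n where c: "\<And>z. g z = (\<Sum>i\<le>n. c i * z ^ i)"
      using pole_at_infinity[OF hol(2)] by metis
    have "g z = poly (\<Sum>i\<le>n. monom (c i) i) z" for z
      by (simp add: c poly_sum poly_monom)
    then show False using nonpoly(2) by blast
  qed
qed

lemma normally_convergent_image:
  assumes f: "continuous_on UNIV f" and "ball z e \<subseteq> U" "d < e"
    and conv: "normally_convergent U (\<lambda>n w. s n (f w))"
  shows "normally_convergent (f ` ball z d) s"
proof -
  define L where "L = cball z d"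
  have L: "compact L" "L \<subseteq> U" "ball z d \<subseteq> L"
    using assms(2,3) by (auto simp: L_def)
  consider \<omega> where "uniform_limit L (\<lambda>n w. s n (f w)) \<omega> sequentially"
    | "\<And>M. eventually (\<lambda>n. \<forall>w\<in>L. M \<le> norm (s n (f w))) sequentially"
    using conv L unfolding normally_convergent_def by meson
  then show ?thesis
  proof cases
    case (1 \<omega>)
    \<comment> \<open>Any preimage of \<open>y\<close> in \<open>L\<close> serves, since
      \<open>s n (f x)\<close> depends on \<open>f x\<close> only.\<close>
    define G where "G = (\<lambda>y. \<omega> (SOME x. x \<in> L \<and> f x = y))"
    have "uniform_limit (f ` L) s G sequentially"
    proof (rule uniform_limitI)
      fix \<epsilon> :: real assume "\<epsilon> > 0"
      from uniform_limitD[OF 1 this]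
      show "\<forall>\<^sub>F n in sequentially. \<forall>y\<in>f ` L. dist (s n y) (G y) < \<epsilon>"
      proof (rule eventually_mono, intro ballI)
        fix n y assume *: "\<forall>x\<in>L. dist (s n (f x)) (\<omega> x) < \<epsilon>" "y \<in> f ` L"
        define x where "x = (SOME x. x \<in> L \<and> f x = y)"
        have "x \<in> L \<and> f x = y"
          unfolding x_def by (rule someI_ex) (use * in auto)
        then show "dist (s n y) (G y) < \<epsilon>"
          using * by (auto simp: G_def x_def)
      qed
    qed
    then have "uniform_limit K s G sequentially" if "K \<subseteq> f ` ball z d" for K
      by (rule uniform_limit_on_subset) (use that L in blast)
    then show ?thesis unfolding normally_convergent_def by blast
  next
    case 2
    have "eventually (\<lambda>n. \<forall>y\<in>K. M \<le> norm (s n y)) sequentially" if "K \<subseteq> f ` ball z d" for K M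
      by (rule eventually_mono[OF 2[of M]]) (use that L in blast)
    then show ?thesis unfolding normally_convergent_def by blast
  qed
qed

lemma funpow_commute:
  assumes "f \<circ> h = h \<circ> f"
  shows "(h ^^ n) (f w) = f ((h ^^ n) w)"
proof (induction n)
  case (Suc n)
  then show ?case using fun_cong[OF assms, of "(h ^^ n) w"] by simp
qed simp

text \<open>It suffices that the iterates of \<open>h\<close> composed with \<open>f\<close> are
  normal near \<open>z\<close>: by the open mapping theorem \<open>f\<close> sends a disc about
  \<open>z\<close> onto a neighbourhood of \<open>f z\<close>, to which normality descends.\<close>

theorem fatou_set_comp_forward_invariant:
  assumes holf: "f holomorphic_on UNIV" and holg: "g holomorphic_on UNIV"
    and fnc: "\<not> f constant_on UNIV" and gnc: "\<not> g constant_on UNIV"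
    and comm: "f \<circ> g = g \<circ> f" and z: "z \<in> fatou_set (f \<circ> g)"
  shows "f z \<in> fatou_set (f \<circ> g)"
proof -
  define h where "h = f \<circ> g"
  have hgf: "h w = g (f w)" for w
    using comm by (simp add: h_def)
  have holh: "h holomorphic_on UNIV"
    unfolding h_def by (rule holomorphic_on_compose_gen[OF holg holf]) auto
  note contf = holomorphic_on_imp_continuous_on[OF holf]
  note contg = holomorphic_on_imp_continuous_on[OF holg]
  have conth: "continuous_on A (h ^^ n)" for A n
    by (intro holomorphic_on_imp_continuous_on holomorphic_on_funpow holh)
  have fh: "f ((h ^^ n) w) = (h ^^ n) (f w)" for n w
    by (rule funpow_commute[symmetric]) (auto simp: h_def comm fun_eq_iff fun_cong[OF comm, unfolded o_def])
  \<comment> \<open>As \<open>f\<close> commutes with \<open>h\<close>, the outer \<open>g\<close>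
    and the inner \<open>f\<close> combine to one more iterate; hence the shift of exponents by
    \<open>Suc\<close> below.\<close>
  have gfh: "g ((h ^^ n) (f w)) = (h ^^ Suc n) w" for n w
    by (simp add: fh[symmetric] hgf)
  obtain e where e: "e > 0" and sub: "\<And>n::nat \<Rightarrow> nat. \<exists>r::nat \<Rightarrow> nat. strict_mono r \<and>
       ((\<exists>g. uniform_limit (cball z e) (\<lambda>k. h ^^ n (r k)) g sequentially) \<or>
        (\<forall>M::real. \<forall>\<^sub>F k in sequentially. \<forall>w\<in>cball z e. M \<le> norm ((h ^^ n (r k)) w)))"
    using fatou_set_subsequence[OF z[folded h_def]] by blast
  have main: "\<exists>r::nat \<Rightarrow> nat. strict_mono r \<and>
      normally_convergent (ball z e) (\<lambda>k w. (h ^^ n (r k)) (f w))" for n :: "nat \<Rightarrow> nat"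
  proof -
    obtain r1 :: "nat \<Rightarrow> nat" where r1: "strict_mono r1"
      and alt1: "(\<exists>g. uniform_limit (cball z e) (\<lambda>k. h ^^ Suc (n (r1 k))) g sequentially) \<or>
        (\<forall>M::real. \<forall>\<^sub>F k in sequentially. \<forall>w\<in>cball z e. M \<le> norm ((h ^^ Suc (n (r1 k))) w))"
      using sub[of "\<lambda>k. Suc (n k)"] by blast
    \<comment> \<open>If \<open>h\<^bsup>n+1\<^esup> = g \<circ> h\<^bsup>n\<^esup> \<circ> f\<close> stays bounded by \<open>B\<close>, then \<open>h\<^bsup>n\<^esup> \<circ> f\<close> omits every value at
      which \<open>\<bar>g\<bar>\<close> exceeds \<open>B\<close>.\<close>
    show ?thesis
      using alt1
    proof (elim disjE exE)
      fix \<phi> assume "uniform_limit (cball z e) (\<lambda>k. h ^^ Suc (n (r1 k))) \<phi> sequentially"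
      then obtain B where "\<forall>\<^sub>F k in sequentially. \<forall>w\<in>cball z e. norm ((h ^^ Suc (n (r1 k))) w) \<le> B"
        by (rule uniform_limit_compact_bounded) (rule compact_cball conth)+
      then obtain N where N: "\<And>k w. k \<ge> N \<Longrightarrow> w \<in> cball z e \<Longrightarrow> norm ((h ^^ Suc (n (r1 k))) w) \<le> B"
        unfolding eventually_sequentially by blast
      have "\<not> bounded (range g)"
        using Liouville_theorem[OF holg] gnc by (metis UNIV_I constant_on_def rangeI)
      then have unb: "\<exists>c. norm (g c) > C" for C
        unfolding bounded_iff by (metis not_le rangeE)
      obtain p where p: "norm (g p) > B" using unb by blast
      \<comment> \<open>Asking for more than \<open>norm (g p)\<close> makes \<open>q\<close>
        different from \<open>p\<close>.\<close>
      obtain q where q: "norm (g q) > norm (g p)" using unb by blast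
      \<comment> \<open>The bound \<open>B\<close> holds only from index \<open>N\<close> on,
        whereas Montel's theorem wants every term to omit \<open>p\<close> and
        \<open>q\<close>.\<close>
      define r where "r = (\<lambda>k. r1 (k + N))"
      have r: "strict_mono r"
        using r1 by (auto simp: r_def strict_mono_def)
      have "\<exists>r'::nat \<Rightarrow> nat. strict_mono r' \<and>
          normally_convergent (ball z e) (\<lambda>k w. (h ^^ n (r (r' k))) (f w))"
      proof (rule Montel_omitting_two_values[of "ball z e" p q "\<lambda>k w. (h ^^ n (r k)) (f w)"])
        show "(\<lambda>w. (h ^^ n (r k)) (f w)) holomorphic_on ball z e" for k
          using holomorphic_on_compose[OF holomorphic_on_subset[OF holf] holomorphic_on_funpow[OF holh]]
          by (simp add: o_def)
        show "(h ^^ n (r k)) (f w) \<noteq> p \<and> (h ^^ n (r k)) (f w) \<noteq> q" if "w \<in> ball z e" for k w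
          using N[of "k + N" w] that p q gfh[of "n (r k)" w] by (auto simp: r_def)
      qed (use q in auto)
      then obtain r' :: "nat \<Rightarrow> nat" where "strict_mono r'"
        "normally_convergent (ball z e) (\<lambda>k w. (h ^^ n (r (r' k))) (f w))" by blast
      then show ?thesis
        using strict_mono_o[OF r] by (intro exI[of _ "r \<circ> r'"]) auto
    next
      assume inf: "\<forall>M::real. \<forall>\<^sub>F k in sequentially. \<forall>w\<in>cball z e. M \<le> norm ((h ^^ Suc (n (r1 k))) w)"
      have "\<forall>\<^sub>F k in sequentially. \<forall>w\<in>K. M \<le> norm ((h ^^ n (r1 k)) (f w))" if K: "K \<subseteq> ball z e" for K M
      proof -
        \<comment> \<open>Since \<open>g\<close> is bounded on discs, its large values come from
          large arguments, so divergence passes from the iterate to the inner function.\<close>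
        obtain M' where M': "\<And>w. M' \<le> norm (g w) \<Longrightarrow> M \<le> norm w"
          using large_argument_if_large_value[OF contg] by blast
        have "\<forall>\<^sub>F k in sequentially. \<forall>w\<in>cball z e. M' \<le> norm ((h ^^ Suc (n (r1 k))) w)"
          using inf by blast
        then show ?thesis
        proof (rule eventually_mono, intro ballI)
          fix k w assume "\<forall>w\<in>cball z e. M' \<le> norm ((h ^^ Suc (n (r1 k))) w)" "w \<in> K"
          then have "M' \<le> norm (g ((h ^^ n (r1 k)) (f w)))"
            unfolding gfh using K by auto
          then show "M \<le> norm ((h ^^ n (r1 k)) (f w))" by (rule M')
        qed
      qed
      then show ?thesis
        using r1 unfolding normally_convergent_def by blast
    qed
  qed
  \<comment> \<open>Half the radius leaves room for a closed disc inside the disc where convergence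
    is known.\<close>
  define W where "W = f ` ball z (e / 2)"
  have "open W"
    unfolding W_def by (rule open_mapping_thm[OF holf _ _ _ _ fnc]) auto
  moreover have "f z \<in> W" using e by (auto simp: W_def)
  moreover have "normal_family W (range (\<lambda>n. h ^^ n))"
    unfolding normal_family_iff
  proof (intro allI impI)
    fix s :: "nat \<Rightarrow> complex \<Rightarrow> complex" assume "\<forall>n. s n \<in> range (\<lambda>n. h ^^ n)"
    then have "\<forall>k. \<exists>m. s k = h ^^ m" by blast
    then obtain n where n: "\<And>k. s k = h ^^ n k" by metis
    obtain r :: "nat \<Rightarrow> nat" where r: "strict_mono r"
      "normally_convergent (ball z e) (\<lambda>k w. (h ^^ n (r k)) (f w))"
      using main by blast
    have "normally_convergent W (\<lambda>k. s (r k))"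
      unfolding W_def n
      by (rule normally_convergent_image[OF contf order_refl _ r(2)]) (use e in auto)
    then show "\<exists>r. strict_mono r \<and> normally_convergent W (\<lambda>n. s (r n))"
      using r(1) by blast
  qed
  ultimately show ?thesis
    unfolding fatou_set_def h_def by blast
qed

section \<open>Invariant open sets and the inclusion of Fatou sets\<close>

lemma open_fatou_set: "open (fatou_set h)"
proof (subst open_subopen, intro ballI)
  fix z assume "z \<in> fatou_set h"
  then obtain U where "open U" "z \<in> U" "normal_family U (range (\<lambda>n. h ^^ n))"
    unfolding fatou_set_def by blast
  then show "\<exists>T. open T \<and> z \<in> T \<and> T \<subseteq> fatou_set h"
    unfolding fatou_set_def by blast
qed

text \<open>Invariance keeps every iterate of a point of \<open>V\<close> in \<open>V\<close>, so on
  discs in \<open>V\<close> all iterates omit \<open>p\<close> and \<open>q\<close> and Montel's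
  theorem applies.\<close>

lemma invariant_open_subset_fatou_set:
  assumes hol: "f holomorphic_on UNIV" and V: "open V" "f ` V \<subseteq> V"
    and pq: "p \<notin> V" "q \<notin> V" "p \<noteq> q"
  shows "V \<subseteq> fatou_set f"
proof
  fix z assume "z \<in> V"
  then obtain e where e: "e > 0" "ball z e \<subseteq> V"
    using V(1) openE by blast
  have inV: "(f ^^ n) w \<in> V" if "w \<in> V" for n w
    by (induction n) (use that V in auto)
  have "normal_family (ball z e) (range (\<lambda>n. f ^^ n))"
    unfolding normal_family_iff
  proof (intro allI impI)
    fix s :: "nat \<Rightarrow> complex \<Rightarrow> complex" assume s: "\<forall>n. s n \<in> range (\<lambda>n. f ^^ n)"
    show "\<exists>r. strict_mono r \<and> normally_convergent (ball z e) (\<lambda>n. s (r n))"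
    proof (rule Montel_omitting_two_values[OF open_ball connected_ball pq(3)])
      fix n
      obtain m where m: "s n = f ^^ m" using s by blast
      show "s n holomorphic_on ball z e"
        unfolding m by (rule holomorphic_on_funpow[OF hol])
      show "s n w \<noteq> p \<and> s n w \<noteq> q" if "w \<in> ball z e" for w
        using inV[of w m] that e pq unfolding m by blast
    qed
  qed
  then show "z \<in> fatou_set f"
    unfolding fatou_set_def using e by (auto intro!: exI[of _ "ball z e"])
qed

lemma fatou_set_comp_subset:
  assumes f: "transcendental_entire f" and g: "transcendental_entire g"
    and comm: "f \<circ> g = g \<circ> f"
  shows "fatou_set (f \<circ> g) \<subseteq> fatou_set f"
proof -
  have hol: "f holomorphic_on UNIV" "g holomorphic_on UNIV"
    using f g by (auto simp: transcendental_entire_def entire_def)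
  have nc: "\<not> k constant_on UNIV" if "transcendental_entire k" for k
  proof
    assume "k constant_on UNIV"
    then obtain c where "\<forall>z. k z = poly [:c:] z" by (auto simp: constant_on_def)
    then show False using that unfolding transcendental_entire_def by blast
  qed
  have holh: "(f \<circ> g) holomorphic_on UNIV"
    by (rule holomorphic_on_compose_gen[OF hol(2,1)]) auto
  note J = julia_set_not_subset_singleton[OF holh transcendental_entire_comp_not_affine[OF f g]]
  \<comment> \<open>The point 0 is an arbitrary choice giving a first Julia point \<open>p\<close>;
    excluding \<open>p\<close> itself then gives a second one.\<close>
  obtain p where p: "p \<notin> fatou_set (f \<circ> g)"
    using J[of 0] by blast
  obtain q where q: "q \<notin> fatou_set (f \<circ> g)" "q \<noteq> p"
    using J[of p] by blast
  show ?thesis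
  proof (rule invariant_open_subset_fatou_set[OF hol(1) open_fatou_set _ p q(1)])
    show "f ` fatou_set (f \<circ> g) \<subseteq> fatou_set (f \<circ> g)"
      using fatou_set_comp_forward_invariant[OF hol nc[OF f] nc[OF g] comm] by blast
  qed (use q in auto)
qed

theorem lemma7:
  fixes f g :: "complex \<Rightarrow> complex"
  assumes "transcendental_entire f" and "transcendental_entire g"
      and "f \<circ> g = g \<circ> f"
  shows "fatou_set (f \<circ> g) \<subseteq> fatou_set f \<inter> fatou_set g"
proof (rule Int_greatest)
  show "fatou_set (f \<circ> g) \<subseteq> fatou_set f"
    by (rule fatou_set_comp_subset[OF assms])
  show "fatou_set (f \<circ> g) \<subseteq> fatou_set g"
    \<comment> \<open>The same inclusion with the roles of \<open>f\<close> and \<open>g\<close>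
      exchanged.\<close>
    by (subst assms(3)) (rule fatou_set_comp_subset[OF assms(2,1) assms(3)[symmetric]])
qed

end
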